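(* For every first-order unification context $\Delta$, the saturation process terminates: every sequence $\Delta=\Delta_1\to\Delta_2\to\cdots$ in which each $\Delta_{i+1}$ is obtained from $\Delta_i$ by applying a saturation rule whose conclusion is not already contained in $\Delta_i$ is finite, and it ends in a saturated context (one to which no rule adds anything new).
   Context: Fix constructors $c,d,e$ (with arities), unification metavariables tagged contractive ($H^{\mathrm{con}}$) or recursive ($H^{\mathrm{rec}}$), and recursion constants $\underline r,\underline s,\underline t$. Contractive terms $U ::= c\,N_1\cdots N_n\mid H^{\mathrm{con}}$; recursive terms $N ::= \underline r\mid H^{\mathrm{rec}}$. A unification context is a finite collection of equations $U_1\doteq U_2$, equations $N_1\doteq N_2$, recursive definitions $\underline r=_dU$, and possibly the symbol $\mathrm{contra}$. Saturation rules (if all premises are in the context, add the conclusion): SIMP-F: $c\,N_1\cdots N_n\doteq d\,N'_1\cdots N'_m$ with $c\neq d$ $\Rightarrow\mathrm{contra}$. SIMP: $c\,N_1\cdots N_n\doteq c\,N'_1\cdots N'_n\Rightarrow N_i\doteq N'_i$ for all $i$. R-EXP: $\underline r\doteq\underline s$, $\underline r=_dU_1$, $\underline s=_dU_2\Rightarrow U_1\doteq U_2$. U-SYM: $U\doteq U'\Rightarrow U'\doteq U$. U-TRANS: $U_1\doteq U_2$, $U_2\doteq U_3\Rightarrow U_1\doteq U_3$. N-SYM, N-TRANS: the same for recursive terms $N$. *)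

theory Defs
  imports Main
begin

text \<open>
  Constructors, recursion constants and metavariable names range over arbitrary types
  \<open>'c\<close>, \<open>'r\<close>, \<open>'h\<close>. The tag of a metavariable is the datatype constructor that holds its
  name: \<open>RMeta h\<close> is the recursive \<open>H\<^sup>r\<^sup>e\<^sup>c\<close>, \<open>CMeta h\<close> the contractive \<open>H\<^sup>c\<^sup>o\<^sup>n\<close>.
\<close>

datatype ('r, 'h) rec_term = RConst 'r | RMeta 'h

datatype ('c, 'r, 'h) con_term = Con 'c "('r, 'h) rec_term list" | CMeta 'h

datatype ('c, 'r, 'h) entry =
    CEq "('c, 'r, 'h) con_term" "('c, 'r, 'h) con_term"  (infix \<open>\<doteq>\<^sub>U\<close> 55)
  | REq "('r, 'h) rec_term" "('r, 'h) rec_term"  (infix \<open>\<doteq>\<^sub>N\<close> 55)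
  | RDef 'r "('c, 'r, 'h) con_term"  (infix \<open>=\<^sub>d\<close> 55)
  | Contra

fun wf_con_term :: "('c \<Rightarrow> nat) \<Rightarrow> ('c, 'r, 'h) con_term \<Rightarrow> bool" where
  "wf_con_term ar (Con c Ns) \<longleftrightarrow> length Ns = ar c"
| "wf_con_term ar (CMeta h) \<longleftrightarrow> True"

fun wf_entry :: "('c \<Rightarrow> nat) \<Rightarrow> ('c, 'r, 'h) entry \<Rightarrow> bool" where
  "wf_entry ar (U \<doteq>\<^sub>U U') \<longleftrightarrow> wf_con_term ar U \<and> wf_con_term ar U'"
| "wf_entry ar (N \<doteq>\<^sub>N N') \<longleftrightarrow> True"
| "wf_entry ar (r =\<^sub>d U) \<longleftrightarrow> wf_con_term ar U"
| "wf_entry ar Contra \<longleftrightarrow> True"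

definition unif_context :: "('c \<Rightarrow> nat) \<Rightarrow> ('c, 'r, 'h) entry set \<Rightarrow> bool" where
  "unif_context ar \<Delta> \<longleftrightarrow> finite \<Delta> \<and> (\<forall>e\<in>\<Delta>. wf_entry ar e)"

text \<open>
  \<open>sat_rule P C\<close>: there is a rule instance with set of premises \<open>P\<close> and set of conclusions
  \<open>C\<close>. Only \<open>simp\<close> can have other than one conclusion: it adds the equations of all the
  arguments at once. In a well-formed context its length condition always holds.
\<close>

inductive sat_rule :: "('c, 'r, 'h) entry set \<Rightarrow> ('c, 'r, 'h) entry set \<Rightarrow> bool" where
  simp_f: "c \<noteq> d \<Longrightarrow> sat_rule {Con c Ns \<doteq>\<^sub>U Con d Ns'} {Contra}"
| simp: "length Ns = length Ns' \<Longrightarrow>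
    sat_rule {Con c Ns \<doteq>\<^sub>U Con c Ns'} {Ns ! i \<doteq>\<^sub>N Ns' ! i |i. i < length Ns}"
| r_exp: "sat_rule {RConst r \<doteq>\<^sub>N RConst s, r =\<^sub>d U1, s =\<^sub>d U2} {U1 \<doteq>\<^sub>U U2}"
| u_sym: "sat_rule {U \<doteq>\<^sub>U U'} {U' \<doteq>\<^sub>U U}"
| u_trans: "sat_rule {U1 \<doteq>\<^sub>U U2, U2 \<doteq>\<^sub>U U3} {U1 \<doteq>\<^sub>U U3}"
| n_sym: "sat_rule {N \<doteq>\<^sub>N N'} {N' \<doteq>\<^sub>N N}"
| n_trans: "sat_rule {N1 \<doteq>\<^sub>N N2, N2 \<doteq>\<^sub>N N3} {N1 \<doteq>\<^sub>N N3}"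

definition sat_step :: "('c, 'r, 'h) entry set \<Rightarrow> ('c, 'r, 'h) entry set \<Rightarrow> bool" where
  "sat_step \<Delta> \<Delta>' \<longleftrightarrow> (\<exists>P C. sat_rule P C \<and> P \<subseteq> \<Delta> \<and> \<not> C \<subseteq> \<Delta> \<and> \<Delta>' = \<Delta> \<union> C)"

definition saturated :: "('c, 'r, 'h) entry set \<Rightarrow> bool" where
  "saturated \<Delta> \<longleftrightarrow> (\<forall>P C. sat_rule P C \<and> P \<subseteq> \<Delta> \<longrightarrow> C \<subseteq> \<Delta>)"

end

theory Submission
  imports Defs
begin

text \<open>
  No rule creates a new term: the contractive terms of a conclusion occur already in the
  premises, and its recursive terms occur there as sides of an equation or as arguments of
  constructors. Hence every context reachable from \<open>\<Delta>\<close> lies in the finite set of entries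
  built from the terms of \<open>\<Delta>\<close>, and a strictly growing chain in it has to stop.
\<close>

fun args :: "('c, 'r, 'h) con_term \<Rightarrow> ('r, 'h) rec_term set" where
  "args (Con c Ns) = set Ns"
| "args (CMeta h) = {}"

fun con_terms :: "('c, 'r, 'h) entry \<Rightarrow> ('c, 'r, 'h) con_term set" where
  "con_terms (U \<doteq>\<^sub>U U') = {U, U'}"
| "con_terms (N \<doteq>\<^sub>N N') = {}"
| "con_terms (r =\<^sub>d U) = {U}"
| "con_terms Contra = {}"

text \<open>Arguments are counted because SIMP turns them into sides of recursive equations. Bodies
  of definitions contribute theirs too, since R-EXP can expose them to SIMP.\<close>

fun rec_terms :: "('c, 'r, 'h) entry \<Rightarrow> ('r, 'h) rec_term set" where
  "rec_terms (N \<doteq>\<^sub>N N') = {N, N'}"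
| "rec_terms e = (\<Union>U\<in>con_terms e. args U)"

text \<open>The part \<open>\<Delta>\<close> supplies the recursive definitions, which no rule ever
  adds.\<close>

definition term_closure :: "('c, 'r, 'h) entry set \<Rightarrow> ('c, 'r, 'h) entry set" where
  "term_closure \<Delta> = \<Delta> \<union> {Contra}
     \<union> case_prod CEq ` ((\<Union>e\<in>\<Delta>. con_terms e) \<times> (\<Union>e\<in>\<Delta>. con_terms e))
     \<union> case_prod REq ` ((\<Union>e\<in>\<Delta>. rec_terms e) \<times> (\<Union>e\<in>\<Delta>. rec_terms e))"

lemma finite_con_terms: "finite (con_terms e)"
  by (cases e) auto

lemma finite_args: "finite (args U)"
  by (cases U) auto

lemma finite_rec_terms: "finite (rec_terms e)"
  by (cases e) (auto simp: finite_args)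

lemma finite_term_closure: "finite \<Delta> \<Longrightarrow> finite (term_closure \<Delta>)"
  unfolding term_closure_def by (auto simp: finite_con_terms finite_rec_terms)

lemma args_con_terms: "U \<in> con_terms e \<Longrightarrow> args U \<subseteq> rec_terms e"
  by (cases e) auto

text \<open>Membership splits into a separate condition on each side, so closure under symmetry and
  transitivity is immediate.\<close>

lemma CEq_in_term_closure:
  "U \<doteq>\<^sub>U U' \<in> term_closure \<Delta> \<longleftrightarrow> {U, U'} \<subseteq> (\<Union>e\<in>\<Delta>. con_terms e)"
  unfolding term_closure_def by force

lemma REq_in_term_closure:
  "N \<doteq>\<^sub>N N' \<in> term_closure \<Delta> \<longleftrightarrow> {N, N'} \<subseteq> (\<Union>e\<in>\<Delta>. rec_terms e)"
  unfolding term_closure_def by force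

lemma RDef_in_term_closure:
  "r =\<^sub>d U \<in> term_closure \<Delta> \<Longrightarrow> U \<in> (\<Union>e\<in>\<Delta>. con_terms e)"
  unfolding term_closure_def by force

lemma Contra_in_term_closure: "Contra \<in> term_closure \<Delta>"
  unfolding term_closure_def by simp

lemma sat_rule_term_closure:
  assumes "sat_rule P C" "P \<subseteq> term_closure \<Delta>"
  shows "C \<subseteq> term_closure \<Delta>"
  using assms
proof cases
  case (simp Ns Ns' c)
  \<comment> \<open>SIMP is the one rule that passes from a term to its arguments; all the others
    only rearrange terms or add \<open>Contra\<close>.\<close>
  have args: "set Ms \<subseteq> (\<Union>e\<in>\<Delta>. rec_terms e)"
    if "Con c Ms \<in> (\<Union>e\<in>\<Delta>. con_terms e)" for Ms
    using that args_con_terms by fastforce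
  have "set Ns \<subseteq> (\<Union>e\<in>\<Delta>. rec_terms e)" "set Ns' \<subseteq> (\<Union>e\<in>\<Delta>. rec_terms e)"
    using assms(2) simp(1) by (simp_all add: CEq_in_term_closure args)
  \<comment> \<open>Equal lengths make \<open>i\<close> a valid index into \<open>Ns'\<close> as
    well.\<close>
  with simp(3) have "Ns ! i \<doteq>\<^sub>N Ns' ! i \<in> term_closure \<Delta>" if "i < length Ns" for i
    using that nth_mem[of i Ns] nth_mem[of i Ns']
    unfolding REq_in_term_closure by (metis empty_subsetI insert_subset subsetD)
  with simp(2) show ?thesis by blast
qed (auto simp: CEq_in_term_closure REq_in_term_closure Contra_in_term_closure
      dest!: RDef_in_term_closure)

lemma sat_step_term_closure:
  "sat_step \<Gamma> \<Gamma>' \<Longrightarrow> \<Gamma> \<subseteq> term_closure \<Delta> \<Longrightarrow> \<Gamma>' \<subseteq> term_closure \<Delta>"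
  unfolding sat_step_def by (meson Un_least sat_rule_term_closure subset_trans)

text \<open>Strictness is the side condition that some conclusion is new.\<close>

lemma sat_step_psubset: "sat_step \<Gamma> \<Gamma>' \<Longrightarrow> \<Gamma> \<subset> \<Gamma>'"
  unfolding sat_step_def by blast

lemma no_infinite_psubset_chain:
  assumes "finite B" "\<And>i. D i \<subseteq> B" "\<And>i. D i \<subset> D (Suc i)"
  shows False
proof -
  have "strict_mono (\<lambda>i. card (D i))"
    unfolding strict_mono_Suc_iff using assms by (meson psubset_card_mono finite_subset)
  \<comment> \<open>A strictly increasing sequence of naturals satisfies \<open>n \<le> f n\<close>;
    the index is chosen one beyond the bound \<open>card B\<close>.\<close>
  then have "Suc (card B) \<le> card (D (Suc (card B)))"
    by (rule strict_mono_imp_increasing)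
  also have "\<dots> \<le> card B"
    using assms by (simp add: card_mono)
  finally show False by simp
qed

theorem theorem2p6:
  fixes ar :: "'c \<Rightarrow> nat" and \<Delta> :: "('c, 'r, 'h) entry set"
  assumes "unif_context ar \<Delta>"
  shows "(\<nexists>D :: nat \<Rightarrow> ('c, 'r, 'h) entry set.
            D 0 = \<Delta> \<and> (\<forall>i. sat_step (D i) (D (Suc i)))) \<and>
         (\<forall>(D :: nat \<Rightarrow> ('c, 'r, 'h) entry set) n.
            D 0 = \<Delta> \<and> (\<forall>i<n. sat_step (D i) (D (Suc i))) \<and> (\<nexists>\<Delta>'. sat_step (D n) \<Delta>')
              \<longrightarrow> saturated (D n))"
proof (rule conjI)
  have "finite (term_closure \<Delta>)"
    using assms by (simp add: unif_context_def finite_term_closure)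
  moreover have "D i \<subseteq> term_closure \<Delta>"
    if "D 0 = \<Delta>" "\<forall>i. sat_step (D i) (D (Suc i))" for D i
  proof (induction i)
    case 0
    show ?case using that(1) by (auto simp: term_closure_def)
  next
    case (Suc i)
    then show ?case using that(2) sat_step_term_closure by blast
  qed
  ultimately show "\<nexists>D. D 0 = \<Delta> \<and> (\<forall>i. sat_step (D i) (D (Suc i)))"
    by (metis no_infinite_psubset_chain sat_step_psubset)
next
  show "\<forall>(D :: nat \<Rightarrow> ('c, 'r, 'h) entry set) n.
      D 0 = \<Delta> \<and> (\<forall>i<n. sat_step (D i) (D (Suc i))) \<and> (\<nexists>\<Delta>'. sat_step (D n) \<Delta>')
        \<longrightarrow> saturated (D n)"
    \<comment> \<open>A rule instance violating saturation is itself a step, to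
      \<open>D n \<union> C\<close>, so a context without a successor is saturated.\<close>
    unfolding saturated_def sat_step_def by blast
qed

end
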